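(* For every $F\in\mathcal{R}[r]$, $$F=\sum_{\substack{k\ge0\\ a_1,\dots,a_k\in L}}\iota\Big[\Big(\frac{\partial}{\partial a_1}\cdots\frac{\partial}{\partial a_k}F\Big)(0)\Big]\cdot\big((a_1,\dots,a_k)\otimes\emptyset\big)$$ and $$F=\sum_{\substack{k\ge0\\ a_1,\dots,a_k\in L}}(-1)^k\,\iota\Big[\Big(\frac{\partial}{\partial a_1}\cdots\frac{\partial}{\partial a_k}F\Big)(1)\Big]\cdot\big(\emptyset\otimes(a_k,a_{k-1},\dots,a_1)\big),$$ where only finitely many summands are nonzero.
   Context: Let $L$ be a set of labels and $r\notin L$. $\mathcal{R}_0$ is the set of finite sequences (including the empty sequence $\emptyset$) of pairwise distinct elements of $L$; $\mathcal{R}$ is the free abelian group on $\mathcal{R}_0$, with bilinear product: for sequences $A,B$ with disjoint entries, $AB$ is the sum of all $\binom{|A|+|B|}{|A|}$ interleavings of $A$ and $B$. $\mathcal{R}[r]$ is the free abelian group on symbols $A\otimes B$, $A,B\in\mathcal{R}_0$ with disjoint entries, with bilinear product $(A\otimes B)(C\otimes D)=(AC)\otimes(BD)$. For $a\in L$, $\frac{\partial}{\partial a}$ is the linear map on $\mathcal{R}[r]$ with $\frac{\partial}{\partial a}\big((a_1,\dots,a_m)\otimes(b_1,\dots,b_n)\big)=[m\ge1, a_m=a](a_1,\dots,a_{m-1})\otimes(b_1,\dots,b_n)-[n\ge1, b_1=a](a_1,\dots,a_m)\otimes(b_2,\dots,b_n)$ (Iverson brackets); $\frac{\partial}{\partial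 a_1}\cdots\frac{\partial}{\partial a_k}F$ means $\frac{\partial}{\partial a_k}$ is applied first. $\iota:\mathcal{R}\to\mathcal{R}[r]$ is linear with $\iota(a_1,\dots,a_n)=\sum_{k=0}^n(a_1,\dots,a_k)\otimes(a_{k+1},\dots,a_n)$. Values at $0$ and $1$ are the linear maps $\mathcal{R}[r]\to\mathcal{R}$ with $(A\otimes B)(0)=[A=\emptyset]\,B$ and $(A\otimes B)(1)=[B=\emptyset]\,A$. *)

theory Defs
  imports "HOL-Algebra.Free_Abelian_Groups"
begin

definition R0 :: "'a set \<Rightarrow> 'a list set" where
  "R0 L = {A. distinct A \<and> set A \<subseteq> L}"

definition R0r :: "'a set \<Rightarrow> ('a list \<times> 'a list) set" where
  "R0r L = {(A, B). A \<in> R0 L \<and> B \<in> R0 L \<and> set A \<inter> set B = {}}"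

text \<open>Elements of the free abelian groups are finitely supported integer-valued functions
  (\<^const>\<open>frag_of\<close> gives the generators, \<^const>\<open>frag_extend\<close> the linear extension).
  The pair \<open>(A, B)\<close> stands for the symbol \<open>A \<otimes> B\<close>.\<close>

definition R :: "'a set \<Rightarrow> ('a list \<Rightarrow>\<^sub>0 int) set" where
  "R L = carrier (free_Abelian_group (R0 L))"

definition Rr :: "'a set \<Rightarrow> ('a list \<times> 'a list \<Rightarrow>\<^sub>0 int) set" where
  "Rr L = carrier (free_Abelian_group (R0r L))"

text \<open>For sequences with disjoint distinct entries the interleavings are pairwise different, so
  the sum over the set \<^term>\<open>shuffles A B\<close> has one term per interleaving. The product of
  sequences with a common entry is not specified in the mathematics; it is totalised by \<open>0\<close>, and
  likewise for \<open>A \<otimes> B\<close>.\<close>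

definition R_mult :: "('a list \<Rightarrow>\<^sub>0 int) \<Rightarrow> ('a list \<Rightarrow>\<^sub>0 int) \<Rightarrow> ('a list \<Rightarrow>\<^sub>0 int)" where
  "R_mult x y = frag_extend (\<lambda>A. frag_extend (\<lambda>B.
     if set A \<inter> set B = {} then (\<Sum>C\<in>shuffles A B. frag_of C) else 0) y) x"

definition tensor :: "('a list \<Rightarrow>\<^sub>0 int) \<Rightarrow> ('a list \<Rightarrow>\<^sub>0 int) \<Rightarrow> ('a list \<times> 'a list \<Rightarrow>\<^sub>0 int)" where
  "tensor x y = frag_extend (\<lambda>A. frag_extend (\<lambda>B.
     if set A \<inter> set B = {} then frag_of (A, B) else 0) y) x"

definition Rr_mult ::
  "('a list \<times> 'a list \<Rightarrow>\<^sub>0 int) \<Rightarrow> ('a list \<times> 'a list \<Rightarrow>\<^sub>0 int) \<Rightarrow> ('a list \<times> 'a list \<Rightarrow>\<^sub>0 int)"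
  (infixl "\<bullet>\<^sub>r" 70) where
  "F \<bullet>\<^sub>r G = frag_extend (\<lambda>(A, B). frag_extend (\<lambda>(C, D).
     tensor (R_mult (frag_of A) (frag_of C)) (R_mult (frag_of B) (frag_of D))) G) F"

definition partial :: "'a \<Rightarrow> ('a list \<times> 'a list \<Rightarrow>\<^sub>0 int) \<Rightarrow> ('a list \<times> 'a list \<Rightarrow>\<^sub>0 int)" where
  "partial a = frag_extend (\<lambda>(A, B).
     (if A \<noteq> [] \<and> last A = a then frag_of (butlast A, B) else 0) -
     (if B \<noteq> [] \<and> hd B = a then frag_of (A, tl B) else 0))"

text \<open>\<^const>\<open>foldr\<close> applies the derivative with respect to the last entry of the list first.\<close>

definition partials :: "'a list \<Rightarrow> ('a list \<times> 'a list \<Rightarrow>\<^sub>0 int) \<Rightarrow> ('a list \<times> 'a list \<Rightarrow>\<^sub>0 int)" where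
  "partials as F = foldr partial as F"

definition iota :: "('a list \<Rightarrow>\<^sub>0 int) \<Rightarrow> ('a list \<times> 'a list \<Rightarrow>\<^sub>0 int)" where
  "iota = frag_extend (\<lambda>A. \<Sum>k\<le>length A. frag_of (take k A, drop k A))"

definition at0 :: "('a list \<times> 'a list \<Rightarrow>\<^sub>0 int) \<Rightarrow> ('a list \<Rightarrow>\<^sub>0 int)" where
  "at0 = frag_extend (\<lambda>(A, B). if A = [] then frag_of B else 0)"

definition at1 :: "('a list \<times> 'a list \<Rightarrow>\<^sub>0 int) \<Rightarrow> ('a list \<Rightarrow>\<^sub>0 int)" where
  "at1 = frag_extend (\<lambda>(A, B). if B = [] then frag_of A else 0)"

text \<open>\<open>s\<close> is the sum over a possibly infinite index set \<open>I\<close> of a family with only finitely many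
  nonzero members; the finiteness is part of the assertion.\<close>

definition has_finite_sum :: "('i \<Rightarrow> 'b::comm_monoid_add) \<Rightarrow> 'i set \<Rightarrow> 'b \<Rightarrow> bool" where
  "has_finite_sum f I s \<longleftrightarrow>
     finite {i \<in> I. f i \<noteq> 0} \<and> s = (\<Sum>i\<in>{i \<in> I. f i \<noteq> 0}. f i)"

end

theory Submission imports Defs begin

text \<open>By linearity let \<open>F = A \<otimes> B\<close>. Applying the derivatives of a sequence and evaluating at \<open>0\<close>
  gives \<open>(-1)^j\<close> times \<open>B\<close> without its first \<open>j\<close> entries if the sequence is an interleaving of \<open>A\<close>
  with the reversal of the first \<open>j\<close> entries of \<open>B\<close>, and \<open>0\<close> otherwise. Grouping the sum by the
  right factor, a suffix of \<open>B\<close> with complementary prefix \<open>P\<close>, the left factor becomes the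
  alternating sum over \<open>j\<close> of the shuffles of \<open>A\<close>, the reversal of the first \<open>j\<close> entries of \<open>P\<close>
  and the remaining entries of \<open>P\<close>. It vanishes for nonempty \<open>P\<close> (the antipode identity of the
  shuffle algebra).

  The second formula is the image of the first under the ring involution
  \<open>A \<otimes> B \<mapsto> rev B \<otimes> rev A\<close>, which exchanges the values at \<open>0\<close> and \<open>1\<close> up to reversal and
  anticommutes with the derivatives.\<close>

lemma frag_extend_frag_extend:
  "frag_extend f (frag_extend g c) = frag_extend (\<lambda>x. frag_extend f (g x)) c"
  using subset_UNIV
  by (induction c rule: frag_induction) (auto simp: frag_extend_diff)

lemma frag_extend_fun_add:
  "frag_extend (\<lambda>x. f x + g x) c = frag_extend f c + frag_extend g c"
  by (simp add: frag_extend_def frag_cmul_distrib2 sum.distrib)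

lemma frag_extend_fun_diff:
  "frag_extend (\<lambda>x. f x - g x) c = frag_extend f c - frag_extend g c"
  using subset_UNIV
  by (induction c rule: frag_induction) (auto simp: frag_extend_diff)

lemma frag_extend_fun_zero [simp]: "frag_extend (\<lambda>x. 0) c = 0"
  by (simp add: frag_extend_def)

lemma frag_cmul_uminus2: "frag_cmul c (- x) = frag_cmul (- c) x"
  by (simp add: poly_mapping_eq_iff fun_eq_iff)

section \<open>First-letter recursions for shuffles\<close>

definition frag_Cons :: "'a \<Rightarrow> ('a list \<Rightarrow>\<^sub>0 int) \<Rightarrow> ('a list \<Rightarrow>\<^sub>0 int)" where
  "frag_Cons x = frag_extend (\<lambda>C. frag_of (x # C))"

text \<open>Counting interleavings with multiplicity makes the first-letter recursions hold for
  arbitrary lists; \<open>shuffle_sum_eq\<close> links this to the set \<open>shuffles\<close> for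
  disjoint lists.\<close>

fun shuffle_sum :: "'a list \<Rightarrow> 'a list \<Rightarrow> ('a list \<Rightarrow>\<^sub>0 int)" where
  "shuffle_sum [] Y = frag_of Y"
| "shuffle_sum X [] = frag_of X"
| "shuffle_sum (x # X) (y # Y) = frag_Cons x (shuffle_sum X (y # Y)) + frag_Cons y (shuffle_sum (x # X) Y)"

lemma shuffle_sum_Nil2 [simp]: "shuffle_sum X [] = frag_of X"
  by (cases X) auto

text \<open>With this operator, the value \<open>0\<close> on \<open>[]\<close> makes the first-letter recursions of shuffles
  uniform in which of the sequences are empty.\<close>

definition lead_Cons :: "('a list \<Rightarrow> ('a list \<Rightarrow>\<^sub>0 int)) \<Rightarrow> 'a list \<Rightarrow> ('a list \<Rightarrow>\<^sub>0 int)" where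
  "lead_Cons f X = (case X of [] \<Rightarrow> 0 | x # X' \<Rightarrow> frag_Cons x (f X'))"

lemma lead_Cons_simps [simp]: "lead_Cons f [] = 0" "lead_Cons f (x # X) = frag_Cons x (f X)"
  by (simp_all add: lead_Cons_def)

lemma frag_Cons_frag_of [simp]: "frag_Cons x (frag_of C) = frag_of (x # C)"
  by (simp add: frag_Cons_def)

lemma shuffle_sum_rec:
  assumes "X \<noteq> [] \<or> Y \<noteq> []"
  shows "shuffle_sum X Y = lead_Cons (\<lambda>X'. shuffle_sum X' Y) X + lead_Cons (\<lambda>Y'. shuffle_sum X Y') Y"
  using assms by (cases X; cases Y) auto

definition shuffle_sum3 :: "'a list \<Rightarrow> 'a list \<Rightarrow> 'a list \<Rightarrow> ('a list \<Rightarrow>\<^sub>0 int)" where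
  "shuffle_sum3 A X Y = frag_extend (\<lambda>C. shuffle_sum C Y) (shuffle_sum A X)"

text \<open>Every word in \<open>frag_Cons x u\<close> is nonempty, so the recursion of
  \<open>shuffle_sum\<close> applies term by term: either \<open>x\<close> comes first, or the first
  letter of \<open>Y\<close> does and \<open>frag_Cons x u\<close> stays intact.\<close>

lemma frag_extend_shuffle_sum_frag_Cons:
  "frag_extend (\<lambda>C. shuffle_sum C Y) (frag_Cons x u) =
     frag_Cons x (frag_extend (\<lambda>C. shuffle_sum C Y) u) +
     lead_Cons (\<lambda>Y'. frag_extend (\<lambda>C. shuffle_sum C Y') (frag_Cons x u)) Y"
  by (cases Y) (auto simp: frag_Cons_def frag_extend_frag_extend frag_extend_fun_add)

lemma frag_Cons_add: "frag_Cons x (u + v) = frag_Cons x u + frag_Cons x v"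
  by (simp add: frag_Cons_def frag_extend_add)

lemma lead_Cons_fun_add: "lead_Cons (\<lambda>Y. f Y + g Y) X = lead_Cons f X + lead_Cons g X"
  by (cases X) (simp_all add: frag_Cons_add)

lemma shuffle_sum3_rec:
  assumes "A \<noteq> [] \<or> X \<noteq> [] \<or> Y \<noteq> []"
  shows "shuffle_sum3 A X Y =
    lead_Cons (\<lambda>A'. shuffle_sum3 A' X Y) A + lead_Cons (\<lambda>X'. shuffle_sum3 A X' Y) X + lead_Cons (\<lambda>Y'. shuffle_sum3 A X Y') Y"
proof (cases "A = [] \<and> X = []")
  case True
  then show ?thesis using assms by (cases Y) (auto simp: shuffle_sum3_def)
next
  case False
  have E: "frag_extend (\<lambda>C. shuffle_sum C Y) (lead_Cons f Z) =
     lead_Cons (\<lambda>Z'. frag_extend (\<lambda>C. shuffle_sum C Y) (f Z')) Z +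
     lead_Cons (\<lambda>Y'. frag_extend (\<lambda>C. shuffle_sum C Y') (lead_Cons f Z)) Y" for f Z
  proof (cases Z)
    case Nil
    then show ?thesis by (cases Y) (simp_all add: frag_Cons_def)
  qed (simp add: frag_extend_shuffle_sum_frag_Cons[of Y])
  have "A \<noteq> [] \<or> X \<noteq> []" using False by auto
  note S = shuffle_sum_rec[OF this]
  show ?thesis
    unfolding shuffle_sum3_def
    \<comment> \<open>\<open>shuffle_sum A X\<close> is expanded on the left and also in the last
      summand, so that the parts starting with a letter of \<open>Y\<close> match after
      \<open>E\<close>.\<close>
    by (subst (1 2) S) (simp add: lead_Cons_fun_add frag_extend_add E[of _ A] E[of _ X] ac_simps)
qed

text \<open>Induction on \<open>A\<close>: once the letters of \<open>B\<close> cancel, what remains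
  is \<open>frag_Cons a\<close> applied to the sum for the tail of \<open>A\<close>, or zero if
  \<open>A\<close> is empty.\<close>

lemma alternating_shuffle_sum3:
  assumes "B \<noteq> []"
  shows "(\<Sum>j\<le>length B. frag_cmul ((-1) ^ j) (shuffle_sum3 A (rev (take j B)) (drop j B))) = 0"
proof (induction A)
  have frag_Cons_sum: "frag_Cons a (\<Sum>j\<in>I. frag_cmul (c j) (h j)) = (\<Sum>j\<in>I. frag_cmul (c j) (frag_Cons a (h j)))"
    if "finite I" for a I and c :: "nat \<Rightarrow> int" and h
    using that by (simp add: frag_Cons_def frag_extend_sum frag_extend_cmul o_def)
  let ?n = "length B"
  \<comment> \<open>Split each shuffle by its first letter: terms with first letter \<open>B ! i\<close> come from
      \<open>j = i\<close> and \<open>j = i + 1\<close> and cancel, so only the first letter of \<open>A\<close> survives.\<close>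
  have telescope: "(\<Sum>j\<le>?n. frag_cmul ((-1) ^ j) (shuffle_sum3 A (rev (take j B)) (drop j B))) =
    (\<Sum>j\<le>?n. frag_cmul ((-1) ^ j) (lead_Cons (\<lambda>A'. shuffle_sum3 A' (rev (take j B)) (drop j B)) A))" for A
  proof -
    define t where "t i = frag_Cons (B ! i) (shuffle_sum3 A (rev (take i B)) (drop (Suc i) B))" for i
    let ?X = "\<lambda>j. frag_cmul ((-1) ^ j) (lead_Cons (\<lambda>X'. shuffle_sum3 A X' (drop j B)) (rev (take j B)))"
    let ?Y = "\<lambda>j. frag_cmul ((-1) ^ j) (lead_Cons (\<lambda>Y'. shuffle_sum3 A (rev (take j B)) Y') (drop j B))"
    have ne: "A \<noteq> [] \<or> rev (take j B) \<noteq> [] \<or> drop j B \<noteq> []" for j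
      using assms by (metis append_Nil append_take_drop_id rev_is_Nil_conv)
    \<comment> \<open>The term \<open>j = 0\<close> vanishes because \<open>rev (take 0 B)\<close>
      is empty. Since \<open>rev (take (Suc i) B)\<close> starts with \<open>B ! i\<close>, the
      index shift gives \<open>t i\<close> with the opposite sign.\<close>
    have "(\<Sum>j\<le>?n. ?X j) = ?X 0 + (\<Sum>i<?n. ?X (Suc i))"
      by (simp only: lessThan_Suc_atMost[symmetric] sum.lessThan_Suc_shift)
    also have "\<dots> = (\<Sum>i<?n. - frag_cmul ((-1) ^ i) (t i))"
      by (simp add: take_Suc_conv_app_nth t_def)
    finally have X: "(\<Sum>j\<le>?n. ?X j) = - (\<Sum>i<?n. frag_cmul ((-1) ^ i) (t i))"
      by (simp only: sum_negf)
    have "(\<Sum>j\<le>?n. ?Y j) = (\<Sum>i<?n. ?Y i) + ?Y ?n"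
      by (simp only: lessThan_Suc_atMost[symmetric] sum.lessThan_Suc)
    also have "\<dots> = (\<Sum>i<?n. frag_cmul ((-1) ^ i) (t i))"
      by (simp add: Cons_nth_drop_Suc[symmetric] t_def)
    finally have Y: "(\<Sum>j\<le>?n. ?Y j) = (\<Sum>i<?n. frag_cmul ((-1) ^ i) (t i))" .
    show ?thesis
      by (subst shuffle_sum3_rec[OF ne]) (simp add: frag_cmul_distrib2 sum.distrib X Y)
  qed
  {
    case Nil
    show ?case by (subst telescope) simp
  next
    case (Cons a A)
    then show ?case by (subst telescope) (simp flip: frag_Cons_sum, simp add: frag_Cons_def)
  }
qed

text \<open>Disjointness forces x \<noteq> y, so interleavings starting with \<open>x\<close> and
  those starting with \<open>y\<close> form disjoint sets and no word is counted twice.\<close>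

lemma shuffle_sum_eq:
  assumes "set X \<inter> set Y = {}"
  shows "shuffle_sum X Y = (\<Sum>C\<in>shuffles X Y. frag_of C)"
  using assms
proof (induction X Y rule: shuffle_sum.induct)
  case (3 x X y Y)
  have "(\<Sum>C\<in>shuffles (x # X) (y # Y). frag_of C) =
    (\<Sum>C\<in>(#) x ` shuffles X (y # Y). frag_of C) + (\<Sum>C\<in>(#) y ` shuffles (x # X) Y. frag_of C)"
    using "3.prems" by (subst shuffles.simps, subst sum.union_disjoint) auto
  then show ?case
    using 3 by (simp add: sum.reindex frag_Cons_def frag_extend_sum o_def)
qed auto

section \<open>Shuffles and reversal\<close>

lemma append_last_in_shuffles:
  assumes "zs \<in> shuffles xs ys"
  shows "zs @ [c] \<in> shuffles (xs @ [c]) ys"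
  using assms
proof (induction zs arbitrary: xs ys)
  case (Cons z zs)
  then show ?case
    using Cons.IH[of "tl xs" ys] Cons.IH[of xs "tl ys"]
    by (cases xs) (auto simp: Cons_in_shuffles_iff simp del: shuffles.simps)
qed auto

lemma rev_in_shuffles:
  assumes "zs \<in> shuffles xs ys"
  shows "rev zs \<in> shuffles (rev xs) (rev ys)"
  using assms
proof (induction zs arbitrary: xs ys)
  case (Cons z zs)
  then consider xs' where "xs = z # xs'" "zs \<in> shuffles xs' ys"
    | ys' where "ys = z # ys'" "zs \<in> shuffles xs ys'"
    by (cases xs; cases ys) (auto simp: Cons_in_shuffles_iff)
  then show ?case
  proof cases
    case 1
    then show ?thesis by (simp add: Cons.IH append_last_in_shuffles)
  next
    case 2
    then have "rev zs @ [z] \<in> shuffles (rev ys' @ [z]) (rev xs)"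
      by (metis Cons.IH append_last_in_shuffles shuffles_commutes)
    then show ?thesis using 2 by (simp add: shuffles_commutes)
  qed
qed auto

lemma shuffles_rev: "shuffles (rev xs) (rev ys) = rev ` shuffles xs ys"
proof
  show "shuffles (rev xs) (rev ys) \<subseteq> rev ` shuffles xs ys"
    using rev_in_shuffles[of _ "rev xs" "rev ys"] by (auto simp: image_iff) (metis rev_rev_ident)
qed (auto intro: rev_in_shuffles)


section \<open>Iterated derivatives and their value at 0\<close>

lemma partial_0 [simp]: "partial a 0 = 0"
  and partial_diff: "partial a (F - G) = partial a F - partial a G"
  by (simp_all add: partial_def frag_extend_diff)

lemma partials_0 [simp]: "partials as 0 = 0"
  and partials_diff: "partials as (F - G) = partials as F - partials as G"
  by (induction as) (simp_all add: partials_def partial_diff)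

lemma at0_diff: "at0 (F - G) = at0 F - at0 G" and at0_0 [simp]: "at0 0 = 0"
  by (simp_all add: at0_def frag_extend_diff)

lemma at0_uminus: "at0 (- F) = - at0 F"
  by (simp add: at0_def frag_extend_minus)

lemma partials_uminus: "partials as (- F) = - partials as F"
  using partials_diff[of as 0 F] by simp

lemma partials_snoc: "partials (as @ [a]) F = partials as (partial a F)"
  by (simp add: partials_def)

text \<open>With the list reversed, induction on \<open>cs\<close> peels off the derivative applied
  first. It removes the first letter of \<open>rev A\<close>, or the first letter of
  \<open>B\<close> at the cost of a sign; \<open>j\<close> counts the letters taken from
  \<open>B\<close>, and evaluation at 0 requires \<open>A\<close> to be used up.\<close>

lemma at0_partials_rev:
  assumes "(A, B) \<in> R0r UNIV"
  shows "at0 (partials (rev cs) (frag_of (A, B))) =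
    (\<Sum>j\<le>length B. if cs \<in> shuffles (rev A) (take j B)
                 then frag_cmul ((-1) ^ j) (frag_of (drop j B)) else 0)"
  using assms
proof (induction cs arbitrary: A B)
  case Nil
  have "(\<Sum>j\<le>length B. if [] \<in> shuffles (rev A) (take j B)
                 then frag_cmul ((-1) ^ j) (frag_of (drop j B)) else 0) =
     (\<Sum>j\<le>length B. if j = 0 then if A = [] then frag_of B else 0 else 0)"
    by (intro sum.cong) auto
  then show ?case
    by (simp add: at0_def partials_def)
next
  case (Cons c cs)
  have D: "distinct A" "distinct B" "set A \<inter> set B = {}"
    using Cons.prems by (auto simp: R0r_def R0_def)
  consider (last) A' where "A = A' @ [c]" | (hd) B' where "B = c # B'" "A = [] \<or> last A \<noteq> c"
    | (none) "A = [] \<or> last A \<noteq> c" "B = [] \<or> hd B \<noteq> c"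
    by (metis append_butlast_last_id list.collapse)
  then show ?case
  proof cases
    case last
    \<comment> \<open>Disjointness keeps \<open>c\<close> out of \<open>B\<close>, so only the
      \<open>A\<close> side contributes to the derivative and to the shuffle.\<close>
    have "partial c (frag_of (A, B)) = frag_of (A', B)"
      using last D by (cases B) (auto simp: partial_def)
    moreover have "c # cs \<in> shuffles (rev A) (take j B) \<longleftrightarrow> cs \<in> shuffles (rev A') (take j B)" for j
      using last D by (auto simp: Cons_in_shuffles_iff dest: in_set_takeD hd_in_set)
    moreover have "(A', B) \<in> R0r UNIV"
      using last D by (auto simp: R0r_def R0_def)
    ultimately show ?thesis
      by (simp add: partials_snoc Cons.IH)
  next
    case hd
    have "partial c (frag_of (A, B)) = - frag_of (A, B')"
      using hd by (auto simp: partial_def)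
    moreover have "c # cs \<in> shuffles (rev A) (take (Suc j) B) \<longleftrightarrow> cs \<in> shuffles (rev A) (take j B')" for j
      using hd by (auto simp: Cons_in_shuffles_iff hd_rev)
    \<comment> \<open>The summand \<open>j = 0\<close> vanishes; in the shifted sum, the extra
      factor -1 is the sign of the derivative.\<close>
    moreover have "c # cs \<notin> shuffles (rev A) (take 0 B)"
      using hd by (auto simp: Cons_in_shuffles_iff hd_rev simp del: shuffles.simps)
    moreover have "(A, B') \<in> R0r UNIV"
      using hd D by (auto simp: R0r_def R0_def)
    moreover have "(\<Sum>j\<le>length B. h j) = h 0 + (\<Sum>j\<le>length B'. h (Suc j))"
      for h :: "nat \<Rightarrow> 'a list \<Rightarrow>\<^sub>0 int"
      using hd by (simp add: sum.atMost_Suc_shift del: sum.atMost_Suc)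
    ultimately show ?thesis
      using hd(1) by (simp add: partials_snoc Cons.IH partials_uminus at0_uminus if_distrib
          del: sum.atMost_Suc flip: sum_negf cong: if_cong)
  next
    case none
    have "partial c (frag_of (A, B)) = 0"
      using none by (auto simp: partial_def)
    moreover have "c # cs \<notin> shuffles (rev A) (take j B)" for j
      using none by (cases j) (auto simp: Cons_in_shuffles_iff hd_rev simp del: shuffles.simps)
    ultimately show ?thesis
      by (simp add: partials_snoc)
  qed
qed

lemma in_shuffles_rev_iff: "rev zs \<in> shuffles (rev xs) ys \<longleftrightarrow> zs \<in> shuffles xs (rev ys)"
  using rev_in_shuffles[of "rev zs" "rev xs" ys] rev_in_shuffles[of zs xs "rev ys"] by auto

lemma at0_partials:
  assumes "(A, B) \<in> R0r UNIV"
  shows "at0 (partials as (frag_of (A, B))) =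
    (\<Sum>j\<le>length B. if as \<in> shuffles A (rev (take j B))
                 then frag_cmul ((-1) ^ j) (frag_of (drop j B)) else 0)"
  using at0_partials_rev[OF assms, of "rev as"] by (simp add: in_shuffles_rev_iff)

text \<open>The hypotheses exclude the default value 0 of the products. The order \<open>C\<close>,
  \<open>A\<close> fits \<open>shuffle_sum3\<close>, whose inner shuffle will supply
  \<open>C\<close>.\<close>

lemma Rr_mult_of:
  assumes "set A \<inter> set C = {}" "set B \<inter> (set A \<union> set C) = {}"
  shows "frag_of (A, B) \<bullet>\<^sub>r frag_of (C, []) = frag_extend (\<lambda>D. frag_of (D, B)) (shuffle_sum C A)"
proof -
  have "frag_extend (\<lambda>D. if set D \<inter> set B = {} then frag_of (D, B) else 0) (\<Sum>D\<in>shuffles A C. frag_of D) =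
     frag_extend (\<lambda>D. frag_of (D, B)) (\<Sum>D\<in>shuffles A C. frag_of D)"
    using assms by (auto simp: frag_extend_sum dest!: set_shuffles intro!: sum.cong)
  then show ?thesis
    using assms by (simp add: Rr_mult_def R_mult_def tensor_def shuffle_sum_eq Int_commute shuffles_commutes[of C])
qed

section \<open>The first formula, on generators and then by linearity\<close>

lemma has_finite_sumI:
  assumes "finite K" "K \<subseteq> I" "\<And>i. i \<in> I \<Longrightarrow> i \<notin> K \<Longrightarrow> f i = 0" "s = sum f K"
  shows "has_finite_sum f I s"
proof -
  have "{i \<in> I. f i \<noteq> 0} \<subseteq> K" using assms by auto
  then show ?thesis
    using assms by (auto simp: has_finite_sum_def finite_subset intro!: sum.mono_neutral_right)
qed

lemma has_finite_sum_of:
  assumes AB: "(A, B) \<in> R0r L"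
  shows "has_finite_sum (\<lambda>as. iota (at0 (partials as (frag_of (A, B)))) \<bullet>\<^sub>r frag_of (as, []))
           (lists L) (frag_of (A, B))"
proof (rule has_finite_sumI)
  have AB': "(A, B) \<in> R0r UNIV"
    and D: "distinct A" "distinct B" "set A \<inter> set B = {}" and L: "set A \<subseteq> L" "set B \<subseteq> L"
    using AB by (auto simp: R0r_def R0_def)
  let ?n = "length B"
  let ?Sh = "\<lambda>j. shuffles A (rev (take j B))"
  \<comment> \<open>By \<open>at0_partials\<close>, the summands vanish outside this finite
    set.\<close>
  let ?K = "\<Union>j\<le>?n. ?Sh j"
  define \<Phi> where "\<Phi> as x = iota x \<bullet>\<^sub>r frag_of (as, [])" for as :: "'a list" and x
  have \<Phi>: "\<Phi> as (at0 (partials as (frag_of (A, B)))) =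
      (\<Sum>j\<le>?n. if as \<in> ?Sh j then frag_cmul ((-1) ^ j) (\<Phi> as (frag_of (drop j B))) else 0)" for as
    by (simp add: at0_partials[OF AB'] \<Phi>_def iota_def Rr_mult_def frag_extend_sum frag_extend_cmul o_def
        if_distrib[of "frag_extend _"] cong: if_cong)
  show "finite ?K" by auto
  show "?K \<subseteq> lists L"
    using L by (auto dest!: set_shuffles) (blast dest: in_set_takeD)+
  show "iota (at0 (partials as (frag_of (A, B)))) \<bullet>\<^sub>r frag_of (as, []) = 0" if "as \<notin> ?K" for as
    using \<Phi>[of as] that by (auto simp: \<Phi>_def intro!: sum.neutral)
  define G where "G m = frag_extend (\<lambda>D :: 'a list. frag_of (D, drop m B))" for m
  \<comment> \<open>Here \<open>k\<close> is the cut made by \<open>iota\<close> in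
    \<open>drop j B\<close>. The entries of \<open>as\<close> come from \<open>A\<close> and
    \<open>take j B\<close>, hence are disjoint from both pieces.\<close>
  have \<Phi>_drop: "\<Phi> as (frag_of (drop j B)) = (\<Sum>k\<le>?n - j. G (j + k) (shuffle_sum as (take k (drop j B))))"
    if "as \<in> ?Sh j" "j \<le> ?n" for as j
  proof -
    have "frag_of (take k (drop j B), drop (j + k) B) \<bullet>\<^sub>r frag_of (as, []) =
       G (j + k) (shuffle_sum as (take k (drop j B)))" for k
      unfolding G_def
    proof (rule Rr_mult_of)
      have B: "B = take j B @ take k (drop j B) @ drop (j + k) B"
        by (metis add.commute append_take_drop_id drop_drop)
      have "distinct (take j B @ take k (drop j B) @ drop (j + k) B)"
        using B D(2) by metis
      moreover have "set A \<inter> set (take j B @ take k (drop j B) @ drop (j + k) B) = {}"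
        using B D(3) by metis
      ultimately show "set (take k (drop j B)) \<inter> set as = {}"
        "set (drop (j + k) B) \<inter> (set (take k (drop j B)) \<union> set as) = {}"
        using set_shuffles[OF that(1)] by auto
    qed
    then show ?thesis
      by (simp add: \<Phi>_def iota_def Rr_mult_def frag_extend_sum o_def add.commute)
  qed
  define g where "g j k = frag_cmul ((-1) ^ j) (G (j + k) (shuffle_sum3 A (rev (take j B)) (take k (drop j B))))" for j k
  have inner: "(\<Sum>as\<in>?Sh j. frag_cmul ((-1) ^ j) (\<Phi> as (frag_of (drop j B)))) = (\<Sum>k\<le>?n - j. g j k)"
    if "j \<le> ?n" for j
  proof -
    have "set A \<inter> set (rev (take j B)) = {}"
      using D by (auto dest: in_set_takeD)
    then have G: "(\<Sum>as\<in>?Sh j. G m (shuffle_sum as Y)) = G m (shuffle_sum3 A (rev (take j B)) Y)" for m Y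
      by (simp add: shuffle_sum3_def shuffle_sum_eq[of A] G_def frag_extend_sum o_def)
    have "(\<Sum>as\<in>?Sh j. frag_cmul ((-1) ^ j) (\<Phi> as (frag_of (drop j B)))) =
       (\<Sum>as\<in>?Sh j. \<Sum>k\<le>?n - j. frag_cmul ((-1) ^ j) (G (j + k) (shuffle_sum as (take k (drop j B)))))"
      using that by (intro sum.cong) (auto simp: \<Phi>_drop frag_cmul_sum o_def)
    also have "\<dots> = (\<Sum>k\<le>?n - j. \<Sum>as\<in>?Sh j. frag_cmul ((-1) ^ j) (G (j + k) (shuffle_sum as (take k (drop j B)))))"
      by (rule sum.swap)
    also have "\<dots> = (\<Sum>k\<le>?n - j. g j k)"
      by (simp add: g_def G[symmetric] frag_cmul_sum o_def)
    finally show ?thesis .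
  qed
  have "(\<Sum>as\<in>?K. \<Phi> as (at0 (partials as (frag_of (A, B))))) =
     (\<Sum>j\<le>?n. \<Sum>as\<in>?K. if as \<in> ?Sh j then frag_cmul ((-1) ^ j) (\<Phi> as (frag_of (drop j B))) else 0)"
    unfolding \<Phi> by (rule sum.swap)
  also have "\<dots> = (\<Sum>j\<le>?n. \<Sum>as\<in>?Sh j. frag_cmul ((-1) ^ j) (\<Phi> as (frag_of (drop j B))))"
    by (rule sum.cong[OF refl], rule sum.mono_neutral_cong_right) auto
  also have "\<dots> = (\<Sum>j\<le>?n. \<Sum>k\<le>?n - j. g j k)"
    by (intro sum.cong) (auto simp: inner)
  also have "\<dots> = (\<Sum>(j, k)\<in>{(j, k). j + k \<le> ?n}. g j k)"
    by (subst sum.Sigma) (auto intro!: sum.cong)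
  \<comment> \<open>Terms with the same m = j + k share the right factor
    \<open>drop m B\<close>.\<close>
  also have "\<dots> = (\<Sum>m\<le>?n. \<Sum>j\<le>m. g j (m - j))"
    by (rule sum.triangle_reindex_eq)
  also have "\<dots> = (\<Sum>m\<le>?n. if m = 0 then frag_of (A, B) else 0)"
  proof (intro sum.cong refl)
    fix m assume m: "m \<in> {..?n}"
    \<comment> \<open>Cutting the prefix \<open>take m B\<close> at \<open>j\<close> gives the
      reversed piece and the remaining piece, as in \<open>alternating_shuffle_sum3\<close>.\<close>
    have "(\<Sum>j\<le>m. g j (m - j)) =
       G m (\<Sum>j\<le>length (take m B). frag_cmul ((-1) ^ j) (shuffle_sum3 A (rev (take j (take m B))) (drop j (take m B))))"
      using m by (auto simp: G_def g_def frag_extend_sum frag_extend_cmul drop_take min_def intro!: sum.cong)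
    also have "\<dots> = (if m = 0 then frag_of (A, B) else 0)"
    proof (cases "m = 0")
      case True
      then show ?thesis by (simp add: G_def shuffle_sum3_def)
    next
      case False
      then have "take m B \<noteq> []" using m by auto
      then show ?thesis
        using False by (subst alternating_shuffle_sum3) (simp_all add: G_def)
    qed
    finally show "(\<Sum>j\<le>m. g j (m - j)) = (if m = 0 then frag_of (A, B) else 0)" .
  qed
  also have "\<dots> = frag_of (A, B)" by simp
  finally show "frag_of (A, B) = (\<Sum>as\<in>?K. iota (at0 (partials as (frag_of (A, B)))) \<bullet>\<^sub>r frag_of (as, []))"
    by (simp add: \<Phi>_def)
qed

lemma has_finite_sum_diff:
  fixes f g :: "'i \<Rightarrow> 'b::ab_group_add"
  assumes "has_finite_sum f I s" "has_finite_sum g I t"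
  shows "has_finite_sum (\<lambda>i. f i - g i) I (s - t)"
proof (rule has_finite_sumI)
  \<comment> \<open>Cancellation may shrink the support of the difference, so all sums are taken
    over the union of the two supports.\<close>
  let ?K = "{i \<in> I. f i \<noteq> 0} \<union> {i \<in> I. g i \<noteq> 0}"
  show "finite ?K" using assms by (auto simp: has_finite_sum_def)
  then have "sum f ?K = s" "sum g ?K = t"
    using assms by (auto simp: has_finite_sum_def intro!: sum.mono_neutral_right)
  then show "s - t = (\<Sum>i\<in>?K. f i - g i)" by (simp add: sum_subtractf)
qed auto

lemma iota_diff: "iota (x - y) = iota x - iota y" and iota_0 [simp]: "iota 0 = 0"
  by (simp_all add: iota_def frag_extend_diff)

lemma Rr_mult_diff_left: "(F - G) \<bullet>\<^sub>r H = F \<bullet>\<^sub>r H - G \<bullet>\<^sub>r H"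
  and Rr_mult_0_left [simp]: "0 \<bullet>\<^sub>r H = 0"
  by (simp_all add: Rr_mult_def frag_extend_diff)

lemma Rr_iff_keys: "F \<in> Rr L \<longleftrightarrow> Poly_Mapping.keys F \<subseteq> R0r L"
  by (simp add: Rr_def)

lemma has_finite_sum_at0:
  assumes "F \<in> Rr L"
  shows "has_finite_sum (\<lambda>as. iota (at0 (partials as F)) \<bullet>\<^sub>r frag_of (as, [])) (lists L) F"
  using assms unfolding Rr_iff_keys
proof (induction F rule: frag_induction)
  case zero
  show ?case by (simp add: has_finite_sum_def)
next
  case (one x)
  then show ?case by (cases x) (simp add: has_finite_sum_of)
next
  case (diff F G)
  then show ?case
    using has_finite_sum_diff[OF diff] by (simp add: partials_diff at0_diff iota_diff Rr_mult_diff_left)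
qed

section \<open>The involution and the second formula\<close>

definition frag_rev :: "('a list \<Rightarrow>\<^sub>0 int) \<Rightarrow> ('a list \<Rightarrow>\<^sub>0 int)" where
  "frag_rev = frag_extend (\<lambda>A. frag_of (rev A))"

definition dual :: "('a list \<times> 'a list \<Rightarrow>\<^sub>0 int) \<Rightarrow> ('a list \<times> 'a list \<Rightarrow>\<^sub>0 int)" where
  "dual = frag_extend (\<lambda>(A, B). frag_of (rev B, rev A))"

lemma dual_of [simp]: "dual (frag_of (A, B)) = frag_of (rev B, rev A)"
  by (simp add: dual_def)

lemma dual_diff: "dual (F - G) = dual F - dual G" and dual_0 [simp]: "dual 0 = 0"
  by (simp_all add: dual_def frag_extend_diff)

lemma dual_dual [simp]: "dual (dual F) = F"
  using subset_UNIV
  by (induction F rule: frag_induction) (auto simp: dual_diff)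

lemma dual_in_Rr: "F \<in> Rr L \<Longrightarrow> dual F \<in> Rr L"
  unfolding Rr_iff_keys dual_def
  by (rule order.trans[OF keys_frag_extend]) (fastforce simp: R0r_def R0_def)

text \<open>The involution exchanges the last entry on the left with the first entry on the right,
  and these enter the derivative with opposite signs.\<close>

lemma partial_dual: "partial a (dual F) = - dual (partial a F)"
  using subset_UNIV
proof (induction F rule: frag_induction)
  case (one x)
  have "tl (rev xs) = rev (butlast xs)" for xs :: "'a list"
    by (metis butlast_rev rev_rev_ident)
  then show ?case
    by (cases x) (auto simp: partial_def last_rev hd_rev dual_diff butlast_rev)
qed (auto simp: partial_diff dual_diff)

lemma dual_cmul: "dual (frag_cmul c F) = frag_cmul c (dual F)"
  by (simp add: dual_def frag_extend_cmul)

lemma partials_dual: "partials as (dual F) = frag_cmul ((-1) ^ length as) (dual (partials as F))"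
proof (induction as)
  case (Cons a as)
  have "partials (a # as) (dual F) = frag_cmul ((-1) ^ length as) (partial a (dual (partials as F)))"
    using Cons by (simp add: partials_def partial_def frag_extend_cmul)
  then show ?case
    by (simp add: partial_dual frag_cmul_uminus2) (simp add: partials_def)
qed (simp add: partials_def)

lemma at0_dual: "at0 (dual F) = frag_rev (at1 F)"
  using subset_UNIV
  by (induction F rule: frag_induction)
    (auto simp: at0_def at1_def frag_rev_def dual_diff frag_extend_diff)

lemma iota_frag_rev: "iota (frag_rev x) = dual (iota x)"
  using subset_UNIV
proof (induction x rule: frag_induction)
  case (one A)
  have "(\<Sum>k\<le>length A. frag_of (take k (rev A), drop k (rev A))) =
     (\<Sum>k\<le>length A. frag_of (rev (drop k A), rev (take k A)))"
    \<comment> \<open>A cut of \<open>rev A\<close> after \<open>k\<close> entries is a cut of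
      \<open>A\<close> after \<open>length A - k\<close> entries.\<close>
    by (rule sum.reindex_bij_witness[where i = "\<lambda>k. length A - k" and j = "\<lambda>k. length A - k"])
      (auto simp: take_rev drop_rev)
  then show ?case
    by (simp add: iota_def frag_rev_def dual_def frag_extend_sum o_def)
qed (auto simp: iota_def frag_rev_def dual_diff frag_extend_diff)

lemma tensor_diff_left: "tensor (x - y) z = tensor x z - tensor y z"
  and tensor_diff_right: "tensor z (x - y) = tensor z x - tensor z y"
  and tensor_0 [simp]: "tensor 0 z = 0" "tensor z 0 = 0"
  by (simp_all add: tensor_def frag_extend_diff frag_extend_fun_diff)

lemma frag_rev_of [simp]: "frag_rev (frag_of A) = frag_of (rev A)"
  by (simp add: frag_rev_def)

lemma frag_rev_diff: "frag_rev (x - y) = frag_rev x - frag_rev y" and frag_rev_0 [simp]: "frag_rev 0 = 0"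
  by (simp_all add: frag_rev_def frag_extend_diff)

lemma dual_tensor: "dual (tensor x y) = tensor (frag_rev y) (frag_rev x)"
  using subset_UNIV
proof (induction x rule: frag_induction)
  case (one A)
  show ?case
    using subset_UNIV
  proof (induction y rule: frag_induction)
    case (one B)
    then show ?case by (auto simp: tensor_def)
  qed (auto simp: tensor_diff_right tensor_diff_left frag_rev_diff dual_diff)
qed (auto simp: tensor_diff_right tensor_diff_left frag_rev_diff dual_diff)

lemma frag_rev_R_mult_of:
  "frag_rev (R_mult (frag_of A) (frag_of B)) = R_mult (frag_of (rev A)) (frag_of (rev B))"
  by (simp add: R_mult_def shuffles_rev sum.reindex frag_rev_def frag_extend_sum o_def)

lemma Rr_mult_diff_right: "H \<bullet>\<^sub>r (F - G) = H \<bullet>\<^sub>r F - H \<bullet>\<^sub>r G"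
  and Rr_mult_0_right [simp]: "H \<bullet>\<^sub>r 0 = 0"
  by (simp_all add: Rr_mult_def frag_extend_diff frag_extend_fun_diff case_prod_unfold)

text \<open>The product acts on each tensor factor separately, so it respects their exchange, and
  reversal maps interleavings bijectively to interleavings.\<close>

lemma dual_Rr_mult: "dual (F \<bullet>\<^sub>r G) = dual F \<bullet>\<^sub>r dual G"
  using subset_UNIV
proof (induction F rule: frag_induction)
  case (one x)
  show ?case
    using subset_UNIV
  proof (induction G rule: frag_induction)
    case (one y)
    then show ?case
      by (cases x; cases y) (simp add: Rr_mult_def dual_tensor frag_rev_R_mult_of)
  qed (auto simp: Rr_mult_diff_right dual_diff)
qed (auto simp: Rr_mult_diff_left dual_diff)

lemma has_finite_sum_dual:
  assumes "has_finite_sum f I s"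
  shows "has_finite_sum (\<lambda>i. dual (f i)) I (dual s)"
proof (rule has_finite_sumI)
  show "finite {i \<in> I. f i \<noteq> 0}" using assms by (simp add: has_finite_sum_def)
  then show "dual s = (\<Sum>i\<in>{i \<in> I. f i \<noteq> 0}. dual (f i))"
    using assms by (simp add: has_finite_sum_def dual_def frag_extend_sum o_def)
qed auto

lemma iota_cmul: "iota (frag_cmul c x) = frag_cmul c (iota x)"
  by (simp add: iota_def frag_extend_cmul)

lemma at0_cmul: "at0 (frag_cmul c x) = frag_cmul c (at0 x)"
  by (simp add: at0_def frag_extend_cmul)

lemma Rr_mult_cmul_left: "frag_cmul c F \<bullet>\<^sub>r G = frag_cmul c (F \<bullet>\<^sub>r G)"
  by (simp add: Rr_mult_def frag_extend_cmul)

theorem mainTheorem5: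
  fixes L :: "'a set" and F :: "'a list \<times> 'a list \<Rightarrow>\<^sub>0 int"
  assumes "F \<in> Rr L"
  shows "has_finite_sum
           (\<lambda>as. iota (at0 (partials as F)) \<bullet>\<^sub>r frag_of (as, [])) (lists L) F \<and>
         has_finite_sum
           (\<lambda>as. frag_cmul ((-1) ^ length as)
                  (iota (at1 (partials as F)) \<bullet>\<^sub>r frag_of ([], rev as))) (lists L) F"
proof
  show "has_finite_sum (\<lambda>as. iota (at0 (partials as F)) \<bullet>\<^sub>r frag_of (as, [])) (lists L) F"
    using assms by (rule has_finite_sum_at0)
  \<comment> \<open>This is the dual of a summand of the first formula for \<open>dual F\<close>.
    The sign comes from \<open>partials_dual\<close>, and \<open>dual\<close> turns
    \<open>(as, [])\<close> into \<open>([], rev as)\<close>.\<close>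
  have "dual (iota (at0 (partials as (dual F))) \<bullet>\<^sub>r frag_of (as, [])) =
      frag_cmul ((-1) ^ length as) (iota (at1 (partials as F)) \<bullet>\<^sub>r frag_of ([], rev as))" for as
    by (simp add: partials_dual at0_cmul at0_dual iota_cmul iota_frag_rev
        Rr_mult_cmul_left dual_cmul dual_Rr_mult)
  then show "has_finite_sum
           (\<lambda>as. frag_cmul ((-1) ^ length as)
                  (iota (at1 (partials as F)) \<bullet>\<^sub>r frag_of ([], rev as))) (lists L) F"
    using has_finite_sum_dual[OF has_finite_sum_at0[OF dual_in_Rr[OF assms]]] by simp
qed

end
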